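(* Suppose $F:\mathbb{R}^d\to\mathbb{R}^d$ is $L$-Lipschitz. Then the total number of while-loop calls in PolyakEG-LS is at most $$\left\lfloor\frac{\log(L\gamma_{-1}/A)}{\log(1/\beta)}\right\rfloor+1,$$ and $\gamma_k\ge\min\left\{\frac{\beta A}{L},\gamma_{-1}\right\}$ for all $k\ge0$.
   Context: PolyakEG-LS takes an initial point $x_0\in\mathbb{R}^d$, an initial step size $\gamma_{-1}>0$, a line search factor $\beta\in(0,1)$ and $0<A\le1$. For $k=0,1,2,\dots$: set $\gamma_k=\gamma_{k-1}$ and $\hat x_k=x_k-\gamma_kF(x_k)$; while $\|F(x_k)-F(\hat x_k)\|>A\|F(x_k)\|$, replace $\gamma_k$ by $\beta\gamma_k$ and recompute $\hat x_k=x_k-\gamma_kF(x_k)$ (each such replacement is one while-loop call); then set $\omega_k=\frac{\langle F(\hat x_k),x_k-\hat x_k\rangle}{\|F(\hat x_k)\|^2}$ and $x_{k+1}=x_k-\omega_kF(\hat x_k)$. The total number of while-loop calls is counted over the whole execution of the algorithm, and the value $\gamma_k$ in the claim is the one after the while loop of iteration $k$ has terminated.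
   Formalization: The bound on the number of while-loop calls is replaced by the maximum of 0 and the stated expression, since that expression is negative when Lγ_{-1} < βA (e.g. F = id, L = A = 1, β = 1/2, γ_{-1} = 1/8) although the number of calls is then 0. *)

theory Defs
  imports "HOL-Analysis.Analysis" "HOL-Library.While_Combinator" "HOL-Library.Extended_Nat"
begin

text \<open>
  A state \<open>(x, g, n)\<close> consists of the iterate \<open>x\<^sub>k\<close>, the current step size and the number of
  while-loop calls executed since the start of the algorithm.  The value \<open>None\<close> stands for a
  line search that does not terminate (see \<^const>\<open>while_option\<close>).
\<close>

definition line_search ::
  "('a::real_inner \<Rightarrow> 'a) \<Rightarrow> real \<Rightarrow> real \<Rightarrow> 'a \<Rightarrow> real \<times> nat \<Rightarrow> (real \<times> nat) option" where
  "line_search F A \<beta> x =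
     while_option
       (\<lambda>(g, n). norm (F x - F (x - g *\<^sub>R F x)) > A * norm (F x))
       (\<lambda>(g, n). (\<beta> * g, Suc n))"

text \<open>
  If \<open>F xh = 0\<close>, the quotient defining \<open>\<omega>\<close> is \<open>0\<close> by the convention \<open>a / 0 = 0\<close>; the update
  \<open>x - \<omega> *\<^sub>R F xh\<close> then equals \<open>x\<close>, whatever value \<open>\<omega>\<close> is given.  From then on the state repeats, so
  neither the step size nor the number of calls differs from those of a run that stops there.
\<close>

definition polyakEG_update :: "('a::real_inner \<Rightarrow> 'a) \<Rightarrow> 'a \<Rightarrow> real \<Rightarrow> 'a" where
  "polyakEG_update F x g =
     (let xh = x - g *\<^sub>R F x;
          \<omega> = (F xh \<bullet> (x - xh)) / (norm (F xh))\<^sup>2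
      in x - \<omega> *\<^sub>R F xh)"

definition polyakEG_LS_step ::
  "('a::real_inner \<Rightarrow> 'a) \<Rightarrow> real \<Rightarrow> real \<Rightarrow> 'a \<times> real \<times> nat \<Rightarrow> ('a \<times> real \<times> nat) option" where
  "polyakEG_LS_step F A \<beta> = (\<lambda>(x, g, n).
     map_option (\<lambda>(g', n'). (polyakEG_update F x g', g', n')) (line_search F A \<beta> x (g, n)))"

text \<open>
  The state after the first \<open>k\<close> iterations, that is, \<open>x\<^sub>k\<close> together with the step size of iteration
  \<open>k - 1\<close>; the parameter \<open>g0\<close> is the initial step size, which has index \<open>-1\<close>.
\<close>

primrec polyakEG_LS_state ::
  "('a::real_inner \<Rightarrow> 'a) \<Rightarrow> real \<Rightarrow> real \<Rightarrow> 'a \<Rightarrow> real \<Rightarrow> nat \<Rightarrow> ('a \<times> real \<times> nat) option" where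
  "polyakEG_LS_state F A \<beta> x0 g0 0 = Some (x0, g0, 0)"
| "polyakEG_LS_state F A \<beta> x0 g0 (Suc k) =
     Option.bind (polyakEG_LS_state F A \<beta> x0 g0 k) (polyakEG_LS_step F A \<beta>)"

text \<open>
  The step size \<open>\<gamma>\<^sub>k\<close> on termination of the while loop of iteration \<open>k\<close>; it is \<open>None\<close> if that loop
  is never reached or does not terminate.
\<close>

definition polyakEG_LS_stepsize ::
  "('a::real_inner \<Rightarrow> 'a) \<Rightarrow> real \<Rightarrow> real \<Rightarrow> 'a \<Rightarrow> real \<Rightarrow> nat \<Rightarrow> real option" where
  "polyakEG_LS_stepsize F A \<beta> x0 g0 k =
     map_option (\<lambda>(x, g, n). g) (polyakEG_LS_state F A \<beta> x0 g0 (Suc k))"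

definition polyakEG_LS_total_calls ::
  "('a::real_inner \<Rightarrow> 'a) \<Rightarrow> real \<Rightarrow> real \<Rightarrow> 'a \<Rightarrow> real \<Rightarrow> enat" where
  "polyakEG_LS_total_calls F A \<beta> x0 g0 =
     (SUP k. case polyakEG_LS_state F A \<beta> x0 g0 k of None \<Rightarrow> \<infinity> | Some (x, g, n) \<Rightarrow> enat n)"

end

theory Submission imports Defs begin

text \<open>
  The line search accepts every step size \<open>g\<close> with \<open>L * g \<le> A\<close>: the trial point is at distance
  \<open>g * norm (F x)\<close> from \<open>x\<close>, so \<open>F\<close> changes by at most \<open>L * g * norm (F x)\<close>.  Hence a step size is
  only ever multiplied by \<open>\<beta>\<close> while it exceeds \<open>A / L\<close> (\<open>rejected_step_size\<close>).  Because the step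
  size is carried over from one iteration to the next and never reset, after \<open>n\<close> calls it equals
  \<open>\<beta> ^ n * g0\<close>, regardless of how the calls are spread over the iterations and of where the iterates
  are.  If \<open>n > 0\<close>, the value before the last call was rejected, that is,
  \<open>A < L * (\<beta> ^ (n - 1) * g0)\<close>; in particular \<open>L > 0\<close> then, so a constant \<open>F\<close> with \<open>L = 0\<close> causes
  no calls.

  Both claims are readings of this one inequality: taking logarithms bounds \<open>n\<close>
  (\<open>backtracked_calls_le\<close>), and multiplying by \<open>\<beta> / L\<close> bounds the current step size from below
  (\<open>backtracked_step_size_ge\<close>).  The bound on \<open>n\<close> holds throughout the run, so it also shows that
  every single line search terminates (\<open>line_search_terminates\<close>).
\<close>

text \<open>
  The invariant of the whole execution.  It does not mention the iterate, which is why it survives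
  the update of \<open>x\<close>.
\<close>

definition backtracked :: "real \<Rightarrow> real \<Rightarrow> real \<Rightarrow> real \<Rightarrow> real \<times> nat \<Rightarrow> bool" where
  "backtracked L A \<beta> g0 = (\<lambda>(g, n).
     g = \<beta> ^ n * g0 \<and> (\<forall>m. n = Suc m \<longrightarrow> A < L * (\<beta> ^ m * g0)))"

lemma rejected_step_size:
  fixes F :: "'a::real_inner \<Rightarrow> 'a"
  assumes lip: "L-lipschitz_on UNIV F" and "0 \<le> g"
    and rejected: "norm (F x - F (x - g *\<^sub>R F x)) > A * norm (F x)"
  shows "A < L * g"
proof (rule ccontr)
  assume "\<not> A < L * g"
  have "norm (F x - F (x - g *\<^sub>R F x)) \<le> L * norm (g *\<^sub>R F x)"
    using lipschitz_onD[OF lip, of x "x - g *\<^sub>R F x"] by (simp add: dist_norm)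
  also have "\<dots> = (L * g) * norm (F x)"
    using \<open>0 \<le> g\<close> by simp
  also have "\<dots> \<le> A * norm (F x)"
    using \<open>\<not> A < L * g\<close> by (intro mult_right_mono) auto
  finally show False
    using rejected by simp
qed

lemma backtracked_calls_le:
  assumes inv: "backtracked L A \<beta> g0 (g, n)"
    and "0 < g0" "0 < \<beta>" "\<beta> < 1" "0 < A"
  shows "int n \<le> max 0 (\<lfloor>ln (L * g0 / A) / ln (1 / \<beta>)\<rfloor> + 1)"
proof (cases n)
  case 0
  then show ?thesis by simp
next
  case (Suc m)
  then have rejected: "A < L * (\<beta> ^ m * g0)"
    using inv by (simp add: backtracked_def)
  have "(1 / \<beta>) ^ m < L * g0 / A"
    using rejected \<open>0 < A\<close> \<open>0 < \<beta>\<close> by (simp add: field_simps)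
  then have "ln ((1 / \<beta>) ^ m) < ln (L * g0 / A)"
    using \<open>0 < \<beta>\<close> by (smt (verit) ln_less_cancel_iff zero_less_divide_1_iff zero_less_power)
  then have "real m * ln (1 / \<beta>) < ln (L * g0 / A)"
    using \<open>0 < \<beta>\<close> by (simp add: ln_realpow)
  moreover have "0 < ln (1 / \<beta>)"
    using \<open>0 < \<beta>\<close> \<open>\<beta> < 1\<close> by (simp add: ln_gt_zero)
  ultimately have "real m < ln (L * g0 / A) / ln (1 / \<beta>)"
    by (simp add: pos_less_divide_eq)
  then have "int m \<le> \<lfloor>ln (L * g0 / A) / ln (1 / \<beta>)\<rfloor>"
    by (simp add: le_floor_iff)
  then show ?thesis
    using Suc by simp
qed

lemma backtracked_step_size_ge:
  assumes inv: "backtracked L A \<beta> g0 (g, n)"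
    and "0 \<le> L" "0 < g0" "0 < \<beta>" "0 < A"
  shows "min (\<beta> * A / L) g0 \<le> g"
proof (cases n)
  case 0
  then show ?thesis using inv by (simp add: backtracked_def)
next
  case (Suc m)
  then have g: "g = \<beta> * (\<beta> ^ m * g0)" and rejected: "A < L * (\<beta> ^ m * g0)"
    using inv by (simp_all add: backtracked_def)
  have "0 < L"
    using rejected \<open>0 \<le> L\<close> \<open>0 < A\<close> by (cases "L = 0") auto
  then have "A / L \<le> \<beta> ^ m * g0"
    using rejected by (simp add: pos_divide_le_eq mult.commute)
  then have "\<beta> * (A / L) \<le> g"
    unfolding g using \<open>0 < \<beta>\<close> by (intro mult_left_mono) auto
  then show ?thesis by simp
qed

text \<open>
  The distance of the call counter from its bound serves as the termination measure: the bound
  holds for the state after a call as well, so the counter stays strictly below it before the call.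
\<close>

lemma line_search_terminates:
  fixes F :: "'a::real_inner \<Rightarrow> 'a"
  assumes lip: "L-lipschitz_on UNIV F"
    and pos: "0 < g0" "0 < \<beta>" "\<beta> < 1" "0 < A"
    and inv: "backtracked L A \<beta> g0 s"
  shows "\<exists>t. line_search F A \<beta> x s = Some t \<and> backtracked L A \<beta> g0 t"
proof -
  define b where "b = (\<lambda>(g::real, n::nat). norm (F x - F (x - g *\<^sub>R F x)) > A * norm (F x))"
  define c where "c = (\<lambda>(g::real, n). (\<beta> * g, Suc n))"
  define N where "N = nat (max 0 (\<lfloor>ln (L * g0 / A) / ln (1 / \<beta>)\<rfloor> + 1))"
  have ls: "line_search F A \<beta> x s = while_option b c s"
    by (simp add: line_search_def b_def c_def)
  have call: "backtracked L A \<beta> g0 (c s)"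
    if "backtracked L A \<beta> g0 s" "b s" for s
  proof -
    obtain g n where s: "s = (g, n)" by fastforce
    have g: "g = \<beta> ^ n * g0"
      using that(1) by (simp add: s backtracked_def)
    then have "A < L * g"
      using that(2) pos by (intro rejected_step_size[OF lip]) (auto simp: s b_def)
    then show ?thesis
      using g by (simp add: s c_def backtracked_def)
  qed
  have decreases: "N - snd (c s) < N - snd s"
    if "backtracked L A \<beta> g0 s" "b s" for s
  proof -
    obtain g n where s: "s = (g, n)" by fastforce
    have "backtracked L A \<beta> g0 (\<beta> * g, Suc n)"
      using call[OF that] by (simp add: s c_def)
    from backtracked_calls_le[OF this pos] have "int (Suc n) \<le> int N"
      by (simp only: N_def)
    then show ?thesis by (simp add: s c_def)
  qed
  obtain t where t: "while_option b c s = Some t"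
    using measure_while_option_Some[of "backtracked L A \<beta> g0" b c "\<lambda>s. N - snd s" s]
      call decreases inv by blast
  have "backtracked L A \<beta> g0 t"
    using while_option_rule[OF _ t, of "backtracked L A \<beta> g0"] call inv by blast
  then show ?thesis using ls t by auto
qed

lemma polyakEG_LS_state_backtracked:
  fixes F :: "'a::real_inner \<Rightarrow> 'a"
  assumes lip: "L-lipschitz_on UNIV F"
    and pos: "0 < g0" "0 < \<beta>" "\<beta> < 1" "0 < A"
  shows "\<exists>x g n. polyakEG_LS_state F A \<beta> x0 g0 k = Some (x, g, n) \<and> backtracked L A \<beta> g0 (g, n)"
proof (induction k)
  case 0
  then show ?case by (simp add: backtracked_def)
next
  case (Suc k)
  then obtain x g n where state: "polyakEG_LS_state F A \<beta> x0 g0 k = Some (x, g, n)"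
    and inv: "backtracked L A \<beta> g0 (g, n)" by blast
  obtain g' n' where "line_search F A \<beta> x (g, n) = Some (g', n')" "backtracked L A \<beta> g0 (g', n')"
    using line_search_terminates[OF lip pos inv, of x] by auto
  then show ?case
    using state by (simp add: polyakEG_LS_step_def)
qed

theorem theorem3p2:
  fixes F :: "real ^ 'd \<Rightarrow> real ^ 'd"
    and x0 :: "real ^ 'd"
    and L A \<beta> \<gamma>init :: real
  assumes "L-lipschitz_on UNIV F"
    and "0 < \<gamma>init"
    and "0 < \<beta>" and "\<beta> < 1"
    and "0 < A" and "A \<le> 1"
  shows "(\<exists>N. polyakEG_LS_total_calls F A \<beta> x0 \<gamma>init = enat N \<and>
              int N \<le> max 0 (\<lfloor>ln (L * \<gamma>init / A) / ln (1 / \<beta>)\<rfloor> + 1)) \<and>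
         (\<forall>k. \<exists>\<gamma>. polyakEG_LS_stepsize F A \<beta> x0 \<gamma>init k = Some \<gamma> \<and>
                  \<gamma> \<ge> min (\<beta> * A / L) \<gamma>init)"
proof (intro conjI allI)
  note state = polyakEG_LS_state_backtracked[OF assms(1-5), of x0]
  define B where "B = nat (max 0 (\<lfloor>ln (L * \<gamma>init / A) / ln (1 / \<beta>)\<rfloor> + 1))"
  have "polyakEG_LS_total_calls F A \<beta> x0 \<gamma>init \<le> enat B"
    unfolding polyakEG_LS_total_calls_def
  proof (rule SUP_least)
    fix k
    obtain x g n where "polyakEG_LS_state F A \<beta> x0 \<gamma>init k = Some (x, g, n)"
      and "backtracked L A \<beta> \<gamma>init (g, n)"
      using state by blast
    then show "(case polyakEG_LS_state F A \<beta> x0 \<gamma>init k of None \<Rightarrow> \<infinity> | Some (x, g, n) \<Rightarrow> enat n)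
        \<le> enat B"
      using backtracked_calls_le[of L A \<beta> \<gamma>init g n] assms(2-5) by (simp add: B_def)
  qed
  then obtain N where "polyakEG_LS_total_calls F A \<beta> x0 \<gamma>init = enat N" "N \<le> B"
    by (cases "polyakEG_LS_total_calls F A \<beta> x0 \<gamma>init") auto
  then show "\<exists>N. polyakEG_LS_total_calls F A \<beta> x0 \<gamma>init = enat N \<and>
      int N \<le> max 0 (\<lfloor>ln (L * \<gamma>init / A) / ln (1 / \<beta>)\<rfloor> + 1)"
    by (intro exI[of _ N]) (simp add: B_def)
next
  fix k
  obtain x g n where state: "polyakEG_LS_state F A \<beta> x0 \<gamma>init (Suc k) = Some (x, g, n)"
    and inv: "backtracked L A \<beta> \<gamma>init (g, n)"
    using polyakEG_LS_state_backtracked[OF assms(1-5)] by blast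
  have "polyakEG_LS_stepsize F A \<beta> x0 \<gamma>init k = Some g"
    unfolding polyakEG_LS_stepsize_def state by simp
  moreover have "min (\<beta> * A / L) \<gamma>init \<le> g"
    using backtracked_step_size_ge[OF inv lipschitz_on_nonneg[OF assms(1)]] assms(2-5) by blast
  ultimately show "\<exists>\<gamma>. polyakEG_LS_stepsize F A \<beta> x0 \<gamma>init k = Some \<gamma> \<and>
      \<gamma> \<ge> min (\<beta> * A / L) \<gamma>init"
    by blast
qed

end
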